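(* Let $0<T_{\min}\le T_{\max}<\infty$, let $H$ be a Hilbert space, let $A$ generate a $C_0$-semigroup $(S(t))_{t\ge0}$ on $H$, let $J\in L(H)$, and let the growth condition (defined in the context) hold for $\mathcal S_{\mathrm{rng}}(T_{\min},T_{\max})$. If there exist a self-adjoint, strongly differentiable $\bar P:[0,T_{\max}]\to L(H)$ with $0\prec\bar P(\tau)\preceq c_PI$ for some $c_P>0$, and self-adjoint operators $Q:[0,T_{\max}]\to L(H)$, $R:[T_{\min},T_{\max}]\to L(H)$ satisfying $Q(\tau)\succeq\alpha_qI$, $R(\theta)\succeq\alpha_rI$ for some $\alpha_q,\alpha_r>0$, such that $$\langle d,(\dot{\bar P}(\tau)+A^*\bar P(\tau)+\bar P(\tau)A+Q(\tau))d\rangle_H=0,\quad d\in D(A),\ \tau\in(0,T_{\max}),$$ $$J^*\bar P(0)J-\bar P(\theta)+R(\theta)=0,\quad\theta\in[T_{\min},T_{\max}],$$ then the impulsive system is strongly UGES over $\mathcal S_{\mathrm{rng}}(T_{\min},T_{\max})$.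
   Context: Setting. $A:D(A)\subset H\to H$ is the semigroup generator; $J\neq0$ and $JD(A)\subset D(A)$ (standing assumptions). $\mathcal S_{0,\infty}$ is the set of sequences $\sigma=\{t_k\}_{k\ge1}$ with, setting $t_0:=0$, $t_{k+1}>t_k$ for all $k\ge0$ and $t_k\to\infty$; $\mathbb T_\sigma:=\{t_k:k\ge1\}$. $\mathcal S_{\mathrm{rng}}(T_{\min},T_{\max}):=\{\sigma\in\mathcal S_{0,\infty}:T_{\min}\le t_{k+1}-t_k\le T_{\max}\ \forall k\ge0\}$. The impulsive system is $\dot x(t)=Ax(t)$ for $t\notin\mathbb T_\sigma$, $x(t)=Jx(t^-)$ for $t\in\mathbb T_\sigma$. Its propagator $U_\sigma(t,s)$, $t\ge s\ge0$, is: $U_\sigma(t,s)=S(t-s)$ if $(s,t]\cap\mathbb T_\sigma=\varnothing$; otherwise, if $t_l<\dots<t_m$ are the impulse times in $(s,t]$, $U_\sigma(t,s)=S(t-t_m)JS(t_m-t_{m-1})J\cdots JS(t_l-s)$. $\kappa_\sigma(t,s):=\#(\mathbb T_\sigma\cap(s,t])$. Strong UGES over a family $\mathcal S$: there exist $M\ge1$, $\alpha>0$, $\rho\in(0,1)$ such that $\|U_\sigma(t,s)\|\le M\rho^{\kappa_\sigma(t,s)}e^{-\alpha(t-s)}$ for all $t\ge s\ge0$ and all $\sigma\in\mathcal S$. Growth condition for $\mathcal S_{\mathrm{rng}}(T_{\min},T_{\max})$: there exist a piecewise continuous $g:\mathbb R_{\ge0}\to\mathbb R_{>0}$ bounded below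 by some $c_0>0$, and $\mu>1$, such that $\|U_\sigma(t,s)x\|\le g(t-s)\mu^{\kappa_\sigma(t,s)}\|x\|$ for all $t\ge s\ge0$, $x\in H$, $\sigma\in\mathcal S_{\mathrm{rng}}(T_{\min},T_{\max})$, and $\sup_{0\le\tau<T_{\max}}g(\tau)<\infty$. Notation: $P\succeq Q$ (resp. $P\succ Q$) means $\langle h,(P-Q)h\rangle_H\ge0$ for all $h\in H$ (resp. $>0$ for all $h\ne0$). Expressions $\langle d,(A^*P+PA)d\rangle_H$ with $d\in D(A)$ are understood as the quadratic form $\langle Ad,Pd\rangle_H+\langle Pd,Ad\rangle_H$. Strongly differentiable: $\tau\mapsto\bar P(\tau)h$ is differentiable for every $h\in H$, with derivative $\dot{\bar P}(\tau)h$. *)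

theory Defs
  imports "HOL-Analysis.Analysis"
begin

text \<open>
  Hilbert spaces are types of sort \<open>{real_inner, banach}\<close>.  A complex Hilbert space is an instance
  through its underlying real Hilbert space, with the real part of its inner product: operator norms
  and adjoints are unchanged, and so are all quadratic forms used below, because they are real-valued.
\<close>

section \<open>Adjoints, self-adjointness and the operator order\<close>

definition adj :: "('a::{real_inner,banach} \<Rightarrow>\<^sub>L 'a) \<Rightarrow> ('a \<Rightarrow>\<^sub>L 'a)" where
  "adj T = Blinfun (adjoint (blinfun_apply T))"

text \<open>
  The library's \<^const>\<open>adjoint\<close> is a choice operator and its existence theorem is limited to
  finite dimension.  Riesz' theorem shows that it is meaningful for all bounded operators on
  a Hilbert space; the resulting characterisation is \<open>inner_adj\<close>.
\<close>

lemma Riesz_representation: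
  fixes f :: "'a::{real_inner,banach} \<Rightarrow> real"
  assumes "bounded_linear f"
  shows "\<exists>z. \<forall>x. f x = inner z x"
proof -
  interpret f: bounded_linear f by fact
  obtain K where K: "\<And>x. \<bar>f x\<bar> \<le> norm x * K" using f.bounded by auto
  define \<phi> where "\<phi> x = (norm x)\<^sup>2 / 2 - f x" for x
  define m where "m = Inf (range \<phi>)"
  have lower: "- (K\<^sup>2 / 2) \<le> \<phi> x" for x
  proof -
    have "f x \<le> norm x * K" using K[of x] by auto
    moreover have "0 \<le> (norm x - K)\<^sup>2" by simp
    ultimately show ?thesis unfolding \<phi>_def by (simp add: power2_diff field_simps)
  qed
  then have bdd: "bdd_below (range \<phi>)" by (intro bdd_belowI2)
  have m_le: "m \<le> \<phi> x" for x unfolding m_def using bdd by (intro cInf_lower) auto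
  have par: "(norm (x - y))\<^sup>2 \<le> 4 * (\<phi> x - m) + 4 * (\<phi> y - m)" for x y
  proof -
    have "\<phi> x + \<phi> y - 2 * \<phi> ((1/2) *\<^sub>R (x + y)) = (norm (x - y))\<^sup>2 / 4"
      unfolding \<phi>_def power2_norm_eq_inner f.scaleR f.add
      by (simp add: inner_add inner_diff inner_commute field_simps)
    then show ?thesis using m_le[of "(1/2) *\<^sub>R (x + y)"] by simp
  qed
  have "\<exists>x. \<phi> x < m + 1 / real (Suc n)" for n
  proof -
    have "\<exists>v\<in>range \<phi>. v < m + 1 / real (Suc n)"
      unfolding m_def by (rule cInf_lessD) auto
    then show ?thesis by auto
  qed
  then obtain X where X: "\<And>n. \<phi> (X n) < m + 1 / real (Suc n)" by metis
  have "Cauchy X"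
  proof (rule metric_CauchyI)
    fix e :: real assume e: "e > 0"
    obtain N where N: "1 / real (Suc N) < e\<^sup>2 / 8"
      using reals_Archimedean[of "e\<^sup>2 / 8"] e by (auto simp del: of_nat_Suc simp: inverse_eq_divide)
    have small: "\<phi> (X i) - m < e\<^sup>2 / 8" if "i \<ge> N" for i
    proof -
      have "1 / real (Suc i) \<le> 1 / real (Suc N)" using that by (simp add: frac_le)
      then show ?thesis using X[of i] N by (simp del: of_nat_Suc)
    qed
    have aux: "a < d" if "a \<le> 4 * b + 4 * c" "b < d / 8" "c < d / 8" for a b c d :: real
      using that by simp
    have "dist (X i) (X j) < e" if "i \<ge> N" "j \<ge> N" for i j
    proof -
      have "(norm (X i - X j))\<^sup>2 < e\<^sup>2"
        by (rule aux[OF par small[OF that(1)] small[OF that(2)]])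
      then show ?thesis using e by (simp add: dist_norm power2_less_imp_less)
    qed
    then show "\<exists>M. \<forall>i\<ge>M. \<forall>j\<ge>M. dist (X i) (X j) < e" by blast
  qed
  then obtain z where z: "X \<longlonglongrightarrow> z" using Cauchy_convergent_iff convergent_def by blast
  have "(\<lambda>n. \<phi> (X n)) \<longlonglongrightarrow> \<phi> z"
    unfolding \<phi>_def by (intro tendsto_intros f.tendsto z) simp
  moreover have "(\<lambda>n. m + 1 / real (Suc n)) \<longlonglongrightarrow> m + 0"
    by (intro tendsto_add tendsto_const LIMSEQ_Suc lim_1_over_n)
  ultimately have "\<phi> z \<le> m"
    using LIMSEQ_le[of "\<lambda>n. \<phi> (X n)" "\<phi> z" "\<lambda>n. m + 1 / real (Suc n)" m] X
    by (auto intro: less_imp_le)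
  then have min: "\<phi> z \<le> \<phi> x" for x using m_le[of x] by simp
  have "f v = inner z v" for v
  proof (cases "v = 0")
    case True then show ?thesis by (simp add: f.zero)
  next
    case False
    define c where "c = inner z v - f v"
    define N where "N = (norm v)\<^sup>2"
    have N: "N > 0" using False by (simp add: N_def)
    have "\<phi> (z + t *\<^sub>R v) - \<phi> z = t * c + t\<^sup>2 * N / 2" for t
      unfolding \<phi>_def c_def N_def power2_norm_eq_inner f.scaleR f.add
      by (simp add: inner_add inner_commute field_simps power2_eq_square)
    from this[of "- c / N"] have "0 \<le> (- c / N) * c + (- c / N)\<^sup>2 * N / 2"
      using min[of "z + (- c / N) *\<^sub>R v"] by linarith
    also have "\<dots> = - (c\<^sup>2 / (2 * N))" using N by (simp add: field_simps power2_eq_square)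
    finally have "c\<^sup>2 / (2 * N) \<le> 0" by simp
    then have "c\<^sup>2 \<le> 0" using N by (simp add: divide_le_0_iff)
    then show ?thesis by (simp add: c_def)
  qed
  then show ?thesis by blast
qed

lemma inner_adj:
  fixes T :: "'a::{real_inner,banach} \<Rightarrow>\<^sub>L 'a"
  shows "inner (adj T x) y = inner x (T y)"
proof -
  let ?A = "adjoint (blinfun_apply T)"
  have "\<forall>y. \<exists>z. \<forall>x. inner y (T x) = inner z x"
    by (intro allI Riesz_representation bounded_linear_inner_right_comp blinfun.bounded_linear_right)
  then obtain B where B: "\<And>x y. inner y (T x) = inner (B y) x" by metis
  then have "\<forall>x y. inner (T x) y = inner x (B y)" by (metis inner_commute)
  then have "\<exists>g. \<forall>x y. inner (T x) y = inner x (g y)" by blast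
  then have *: "inner (T x) y = inner x (?A y)" for x y
    unfolding adjoint_def by (rule someI2_ex) blast
  have "bounded_linear ?A"
  proof (rule bounded_linear_intro[where K = "norm T"])
    show "?A (x + y) = ?A x + ?A y" for x y
      by (rule vector_eq_ldot[THEN iffD1]) (simp add: inner_add_right *[symmetric])
    show "?A (r *\<^sub>R x) = r *\<^sub>R ?A x" for r x
      by (rule vector_eq_ldot[THEN iffD1]) (simp add: *[symmetric])
    show "norm (?A x) \<le> norm x * norm T" for x
    proof (cases "?A x = 0")
      case False
      have "norm (?A x) * norm (?A x) = inner (T (?A x)) x"
        by (simp add: * power2_norm_eq_inner[symmetric] power2_eq_square)
      also have "\<dots> \<le> norm (T (?A x)) * norm x" by (rule norm_cauchy_schwarz)
      also have "\<dots> \<le> (norm T * norm (?A x)) * norm x"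
        by (intro mult_right_mono norm_blinfun) auto
      finally have "norm (?A x) * norm (?A x) \<le> norm (?A x) * (norm x * norm T)"
        by (simp add: mult_ac)
      then show ?thesis using False by simp
    qed simp
  qed
  then show ?thesis
    unfolding adj_def using * by (simp add: bounded_linear_Blinfun_apply inner_commute)
qed

definition self_adjoint :: "('a::{real_inner,banach} \<Rightarrow>\<^sub>L 'a) \<Rightarrow> bool" where
  "self_adjoint T \<longleftrightarrow> adj T = T"

definition op_le :: "('a::{real_inner,banach} \<Rightarrow>\<^sub>L 'a) \<Rightarrow> ('a \<Rightarrow>\<^sub>L 'a) \<Rightarrow> bool"  (infix "\<preceq>" 50) where
  "Q \<preceq> P \<longleftrightarrow> (\<forall>h. 0 \<le> inner h ((P - Q) h))"

text \<open>Strict order is pointwise: \<open>0 \<prec> P\<close> does not give a uniform (coercive) lower bound.\<close>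

definition op_less :: "('a::{real_inner,banach} \<Rightarrow>\<^sub>L 'a) \<Rightarrow> ('a \<Rightarrow>\<^sub>L 'a) \<Rightarrow> bool"  (infix "\<prec>" 50) where
  "Q \<prec> P \<longleftrightarrow> (\<forall>h. h \<noteq> 0 \<longrightarrow> 0 < inner h ((P - Q) h))"

section \<open>Strong differentiability of operator-valued functions\<close>

text \<open>Derivatives are relative to the domain \<open>I\<close>, hence one-sided at the endpoints of an interval.\<close>

definition strongly_differentiable_on ::
    "(real \<Rightarrow> ('a::{real_inner,banach} \<Rightarrow>\<^sub>L 'a)) \<Rightarrow> real set \<Rightarrow> bool" where
  "strongly_differentiable_on P I \<longleftrightarrow>
     (\<forall>h. \<forall>\<tau>\<in>I. (\<lambda>\<tau>. P \<tau> h) differentiable (at \<tau> within I))"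

definition strong_derivative ::
    "(real \<Rightarrow> ('a::{real_inner,banach} \<Rightarrow>\<^sub>L 'a)) \<Rightarrow> real set \<Rightarrow> real \<Rightarrow> 'a \<Rightarrow> 'a" where
  "strong_derivative P I \<tau> h = vector_derivative (\<lambda>\<tau>. P \<tau> h) (at \<tau> within I)"

section \<open>Semigroups and their generators\<close>

text \<open>Only the values \<open>S t\<close> for \<open>t \<ge> 0\<close> are relevant.\<close>

definition C0_semigroup :: "(real \<Rightarrow> ('a::{real_inner,banach} \<Rightarrow>\<^sub>L 'a)) \<Rightarrow> bool" where
  "C0_semigroup S \<longleftrightarrow>
     S 0 = id_blinfun \<and>
     (\<forall>s\<ge>0. \<forall>t\<ge>0. S (s + t) = S s o\<^sub>L S t) \<and>
     (\<forall>x. ((\<lambda>t. S t x) \<longlongrightarrow> x) (at_right 0))"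

text \<open>The unbounded operator \<open>A\<close> with domain \<open>D\<close> is a function that is only relevant on \<open>D\<close>.\<close>

definition generator ::
    "('a::{real_inner,banach} \<Rightarrow> 'a) \<Rightarrow> 'a set \<Rightarrow> (real \<Rightarrow> ('a \<Rightarrow>\<^sub>L 'a)) \<Rightarrow> bool" where
  "generator A D S \<longleftrightarrow>
     C0_semigroup S \<and>
     D = {x. \<exists>y. ((\<lambda>t. (1 / t) *\<^sub>R (S t x - x)) \<longlongrightarrow> y) (at_right 0)} \<and>
     (\<forall>x\<in>D. ((\<lambda>t. (1 / t) *\<^sub>R (S t x - x)) \<longlongrightarrow> A x) (at_right 0))"

section \<open>Impulse time sequences\<close>

text \<open>A sequence \<open>{t\<^sub>k}\<close>, \<open>k \<ge> 1\<close>, is stored with the convention \<open>t\<^sub>0 = 0\<close>; time \<open>0\<close> is no impulse.\<close>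

definition impulse_seqs :: "(nat \<Rightarrow> real) set" where
  "impulse_seqs =
     {\<sigma>. \<sigma> 0 = 0 \<and> (\<forall>k. \<sigma> k < \<sigma> (Suc k)) \<and> filterlim \<sigma> at_top sequentially}"

definition impulse_seqs_rng :: "real \<Rightarrow> real \<Rightarrow> (nat \<Rightarrow> real) set" where
  "impulse_seqs_rng Tmin Tmax =
     {\<sigma>\<in>impulse_seqs. \<forall>k. Tmin \<le> \<sigma> (Suc k) - \<sigma> k \<and> \<sigma> (Suc k) - \<sigma> k \<le> Tmax}"

definition impulse_times :: "(nat \<Rightarrow> real) \<Rightarrow> real set" where
  "impulse_times \<sigma> = \<sigma> ` {1..}"

definition impulse_count :: "(nat \<Rightarrow> real) \<Rightarrow> real \<Rightarrow> real \<Rightarrow> nat" where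
  "impulse_count \<sigma> t s = card (impulse_times \<sigma> \<inter> {s<..t})"

section \<open>The propagator of the impulsive system\<close>

text \<open>
  For an increasing list \<open>[t\<^sub>l, \<dots>, t\<^sub>m]\<close> of times, \<open>impulse_prod S J t s\<close> yields
  \<open>S (t - t\<^sub>m) J S (t\<^sub>m - t\<^sub>m\<^sub>-\<^sub>1) J \<cdots> J S (t\<^sub>l - s)\<close>.
\<close>

fun impulse_prod ::
    "(real \<Rightarrow> ('a::{real_inner,banach} \<Rightarrow>\<^sub>L 'a)) \<Rightarrow> ('a \<Rightarrow>\<^sub>L 'a) \<Rightarrow> real \<Rightarrow> real \<Rightarrow> real list \<Rightarrow> ('a \<Rightarrow>\<^sub>L 'a)"
where
  "impulse_prod S J t s [] = S (t - s)"
| "impulse_prod S J t s (r # rs) = impulse_prod S J t r rs o\<^sub>L J o\<^sub>L S (r - s)"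

definition propagator ::
    "(real \<Rightarrow> ('a::{real_inner,banach} \<Rightarrow>\<^sub>L 'a)) \<Rightarrow> ('a \<Rightarrow>\<^sub>L 'a) \<Rightarrow> (nat \<Rightarrow> real) \<Rightarrow> real \<Rightarrow> real \<Rightarrow> ('a \<Rightarrow>\<^sub>L 'a)"
where
  "propagator S J \<sigma> t s =
     impulse_prod S J t s (sorted_list_of_set (impulse_times \<sigma> \<inter> {s<..t}))"

text \<open>
  \<^const>\<open>sorted_list_of_set\<close> is meaningful on finite sets only, and \<^const>\<open>card\<close> likewise:
\<close>

lemma finite_impulse_times:
  assumes "\<sigma> \<in> impulse_seqs"
  shows "finite (impulse_times \<sigma> \<inter> {s<..t})"
proof -
  have "eventually (\<lambda>k. t < \<sigma> k) sequentially"
    using assms by (simp add: impulse_seqs_def filterlim_at_top_dense)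
  then obtain N where "\<And>k. k \<ge> N \<Longrightarrow> t < \<sigma> k" by (auto simp: eventually_sequentially)
  then have "k < N" if "\<sigma> k \<le> t" for k using that by (meson not_le)
  then have "impulse_times \<sigma> \<inter> {s<..t} \<subseteq> \<sigma> ` {..<N}"
    by (auto simp: impulse_times_def)
  then show ?thesis by (rule finite_subset) simp
qed

definition strongly_UGES ::
    "(real \<Rightarrow> ('a::{real_inner,banach} \<Rightarrow>\<^sub>L 'a)) \<Rightarrow> ('a \<Rightarrow>\<^sub>L 'a) \<Rightarrow> (nat \<Rightarrow> real) set \<Rightarrow> bool" where
  "strongly_UGES S J \<S> \<longleftrightarrow>
     (\<exists>M \<alpha> \<rho>. M \<ge> 1 \<and> \<alpha> > 0 \<and> 0 < \<rho> \<and> \<rho> < 1 \<and>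
        (\<forall>\<sigma>\<in>\<S>. \<forall>s t. 0 \<le> s \<and> s \<le> t \<longrightarrow>
           norm (propagator S J \<sigma> t s) \<le> M * \<rho> ^ impulse_count \<sigma> t s * exp (- \<alpha> * (t - s))))"

section \<open>The growth condition\<close>

text \<open>
  Piecewise continuity on \<open>[0, \<infinity>)\<close>: finitely many discontinuities in each bounded interval, and
  finite one-sided limits everywhere.
\<close>

definition piecewise_continuous_nonneg :: "(real \<Rightarrow> real) \<Rightarrow> bool" where
  "piecewise_continuous_nonneg g \<longleftrightarrow>
     (\<forall>T\<ge>0. finite {\<tau>\<in>{0..T}. \<not> continuous (at \<tau> within {0..}) g}) \<and>
     (\<forall>\<tau>\<ge>0. \<exists>l. (g \<longlongrightarrow> l) (at_right \<tau>)) \<and>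
     (\<forall>\<tau>>0. \<exists>l. (g \<longlongrightarrow> l) (at_left \<tau>))"

definition growth_condition ::
    "(real \<Rightarrow> ('a::{real_inner,banach} \<Rightarrow>\<^sub>L 'a)) \<Rightarrow> ('a \<Rightarrow>\<^sub>L 'a) \<Rightarrow> real \<Rightarrow> real \<Rightarrow> bool" where
  "growth_condition S J Tmin Tmax \<longleftrightarrow>
     (\<exists>g c\<^sub>0 \<mu>. piecewise_continuous_nonneg g \<and> c\<^sub>0 > 0 \<and> (\<forall>\<tau>\<ge>0. c\<^sub>0 \<le> g \<tau>) \<and> \<mu> > 1 \<and>
        (\<forall>\<sigma>\<in>impulse_seqs_rng Tmin Tmax. \<forall>s t x. 0 \<le> s \<and> s \<le> t \<longrightarrow>
           norm (propagator S J \<sigma> t s x) \<le> g (t - s) * \<mu> ^ impulse_count \<sigma> t s * norm x) \<and>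
        bdd_above (g ` {0..<Tmax}))"

end

theory Submission
  imports Defs
begin

text \<open>
  The Lyapunov function is the quadratic form of \<open>P \<tau>\<close>, where \<open>\<tau>\<close> is the time since the last impulse.
  By the differential equation and \<open>Q \<ge> 0\<close> it does not increase between impulses
  (\<open>quadratic_form_nonincreasing\<close>).  Orbits are differentiable only if they start in the domain of
  the generator, so this is shown there first and then extended by density
  (\<open>generator_domain_dense\<close>).  At an impulse the jump equation and \<open>P \<theta> \<le> c\<^sub>P\<close>, \<open>R \<theta> \<ge> \<alpha>\<^sub>r\<close> contract
  it by the factor \<open>1 - \<alpha>\<^sub>r / c\<^sub>P\<close>.

  The difficulty is to return to the norm, since \<open>P \<tau>\<close> is only pointwise positive.  But
  \<open>P \<theta> = J\<^sup>* (P 0) J + R \<theta> \<ge> \<alpha>\<^sub>r\<close> for \<open>\<theta>\<close> in \<open>{Tmin..Tmax}\<close>, so the form is coercive just before every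
  impulse, and the norm decays geometrically along these moments (\<open>impulse_prod_decay\<close>).
  In the stretches before the first and after the last impulse, each no longer than \<open>Tmax\<close>, the
  semigroup is bounded by the growth condition (\<open>growth_condition_semigroup_bounded\<close>).  This gives decay in
  the number of impulses, and because consecutive impulses are at most \<open>Tmax\<close> apart, also decay in
  time (\<open>strongly_UGES_of_sampled_decay\<close>).
\<close>

section \<open>Orbits of a semigroup that is bounded on an interval\<close>

lemma semigroup_add:
  assumes "C0_semigroup S" "0 \<le> s" "0 \<le> t"
  shows "S (s + t) x = S s (S t x)"
  using assms by (simp add: C0_semigroup_def)

text \<open>
  The earlier of the two operators factors out of the difference, so that continuity of orbits,
  from the left as well as from the right, is reduced to continuity at time \<open>0\<close>.
\<close>

lemma orbit_increment_le:
  assumes S: "C0_semigroup S" and C: "\<And>t. t \<in> {0..T} \<Longrightarrow> norm (S t) \<le> C"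
    and s: "s \<in> {0..T}" and t: "t \<in> {0..T}"
  shows "norm (S s x - S t x) \<le> C * norm (S \<bar>s - t\<bar> x - x)"
proof -
  have *: "norm (S b x - S a x) \<le> C * norm (S (b - a) x - x)" if "0 \<le> a" "a \<le> b" "b \<le> T" for a b
  proof -
    have "S b x - S a x = S a (S (b - a) x - x)"
      using semigroup_add[OF S, of a "b - a" x] that by (simp add: blinfun.diff_right)
    also have "norm \<dots> \<le> norm (S a) * norm (S (b - a) x - x)" by (rule norm_blinfun)
    also have "\<dots> \<le> C * norm (S (b - a) x - x)" using C[of a] that by (intro mult_right_mono) auto
    finally show ?thesis .
  qed
  show ?thesis using *[of s t] *[of t s] s t by (cases "s \<le> t") (auto simp: norm_minus_commute)
qed

lemma filterlim_abs_diff_at_right: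
  "filterlim (\<lambda>u. \<bar>u - t\<bar>) (at_right 0) (at t within X)" for t :: real
proof -
  have "((\<lambda>u. \<bar>u - t\<bar>) \<longlongrightarrow> \<bar>t - t\<bar>) (at t within X)" by (intro tendsto_intros)
  then show ?thesis
    by (auto simp: filterlim_at eventually_at_filter)
qed

lemma continuous_on_orbit:
  assumes S: "C0_semigroup S" and C: "\<And>t. t \<in> {0..T} \<Longrightarrow> norm (S t) \<le> C"
  shows "continuous_on {0..T} (\<lambda>t. S t x)"
  unfolding continuous_on
proof
  fix t assume t: "t \<in> {0..T}"
  have "((\<lambda>h. S h x) \<longlongrightarrow> x) (at_right 0)" using S by (simp add: C0_semigroup_def)
  then have "((\<lambda>u. S \<bar>u - t\<bar> x) \<longlongrightarrow> x) (at t within {0..T})"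
    by (rule filterlim_compose[OF _ filterlim_abs_diff_at_right])
  then have "((\<lambda>u. C * norm (S \<bar>u - t\<bar> x - x)) \<longlongrightarrow> C * norm (x - x)) (at t within {0..T})"
    by (intro tendsto_intros)
  then have bound: "((\<lambda>u. C * norm (S \<bar>u - t\<bar> x - x)) \<longlongrightarrow> 0) (at t within {0..T})" by simp
  have "\<forall>\<^sub>F u in at t within {0..T}. norm (S u x - S t x) \<le> C * norm (S \<bar>u - t\<bar> x - x)"
    using orbit_increment_le[OF S C _ t, of _ x] by (simp add: eventually_at_filter)
  then have "((\<lambda>u. S u x - S t x) \<longlongrightarrow> 0) (at t within {0..T})"
    by (rule Lim_null_comparison[OF _ bound])
  then show "((\<lambda>u. S u x) \<longlongrightarrow> S t x) (at t within {0..T})" by (simp add: LIM_zero_iff)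
qed

section \<open>The generator and its domain\<close>

lemma generator_limit:
  assumes "generator A D S" "d \<in> D"
  shows "((\<lambda>t. (1 / t) *\<^sub>R (S t d - d)) \<longlongrightarrow> A d) (at_right 0)"
  using assms by (simp add: generator_def)

lemma generator_domainI:
  assumes "generator A D S" "((\<lambda>t. (1 / t) *\<^sub>R (S t d - d)) \<longlongrightarrow> y) (at_right 0)"
  shows "d \<in> D" "A d = y"
proof -
  show "d \<in> D" using assms by (auto simp: generator_def)
  show "A d = y"
    using tendsto_unique[OF _ generator_limit[OF assms(1) \<open>d \<in> D\<close>] assms(2)] by simp
qed

lemma generator_commutes_semigroup:
  assumes G: "generator A D S" and d: "d \<in> D" and \<tau>: "0 \<le> \<tau>"
  shows "S \<tau> d \<in> D" "A (S \<tau> d) = S \<tau> (A d)"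
proof -
  have S: "C0_semigroup S" using G by (simp add: generator_def)
  have "((\<lambda>t. S \<tau> ((1 / t) *\<^sub>R (S t d - d))) \<longlongrightarrow> S \<tau> (A d)) (at_right 0)"
    by (intro tendsto_intros generator_limit[OF G d])
  moreover have "eventually (\<lambda>t. S \<tau> ((1 / t) *\<^sub>R (S t d - d)) = (1 / t) *\<^sub>R (S t (S \<tau> d) - S \<tau> d)) (at_right 0)"
    using eventually_at_right_less
  proof eventually_elim
    case (elim t)
    then show ?case
      using semigroup_add[OF S, of t \<tau> d] semigroup_add[OF S, of \<tau> t d] \<tau>
      by (simp add: blinfun.scaleR_right blinfun.diff_right add.commute)
  qed
  ultimately have "((\<lambda>t. (1 / t) *\<^sub>R (S t (S \<tau> d) - S \<tau> d)) \<longlongrightarrow> S \<tau> (A d)) (at_right 0)"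
    by (rule Lim_transform_eventually)
  then show "S \<tau> d \<in> D" "A (S \<tau> d) = S \<tau> (A d)" using generator_domainI[OF G] by blast+
qed

lemma has_vector_derivative_iff_slope:
  "(f has_vector_derivative D) (at t within X) \<longleftrightarrow>
     ((\<lambda>u. (1 / (u - t)) *\<^sub>R (f u - f t)) \<longlongrightarrow> D) (at t within X)"
proof -
  have "norm ((f u - f t) - (u - t) *\<^sub>R D) / norm (u - t) = norm ((1 / (u - t)) *\<^sub>R (f u - f t) - D)"
    if "u \<noteq> t" for u
  proof -
    have "(1 / (u - t)) *\<^sub>R (f u - f t) - D = (1 / (u - t)) *\<^sub>R ((f u - f t) - (u - t) *\<^sub>R D)"
      using that by (simp add: scaleR_diff_right)
    then show ?thesis by simp
  qed
  then have "((\<lambda>u. norm ((f u - f t) - (u - t) *\<^sub>R D) / norm (u - t)) \<longlongrightarrow> 0) (at t within X) \<longleftrightarrow>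
      ((\<lambda>u. norm ((1 / (u - t)) *\<^sub>R (f u - f t) - D)) \<longlongrightarrow> 0) (at t within X)"
    by (intro Lim_cong_within) auto
  then show ?thesis
    unfolding has_vector_derivative_def has_derivative_iff_norm
    by (simp add: tendsto_norm_zero_iff LIM_zero_iff bounded_linear_scaleR_left)
qed

text \<open>
  The generator only controls the right difference quotient at time \<open>0\<close>.  With \<open>h = \<bar>u - t\<bar>\<close> the
  difference quotient of the orbit between \<open>t\<close> and \<open>u\<close> is \<open>S (min u t)\<close> applied to
  \<open>(1 / h) *\<^sub>R (S h d - d)\<close> on either side of \<open>t\<close>; boundedness and strong continuity of \<open>S\<close> then
  give the limit \<open>S t (A d)\<close>.
\<close>

lemma orbit_has_vector_derivative:
  assumes G: "generator A D S" and C: "\<And>t. t \<in> {0..T} \<Longrightarrow> norm (S t) \<le> C"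
    and d: "d \<in> D" and t: "t \<in> {0..T}"
  shows "((\<lambda>u. S u d) has_vector_derivative S t (A d)) (at t within {0..T})"
proof -
  have S: "C0_semigroup S" using G by (simp add: generator_def)
  let ?F = "at t within {0..T}"
  let ?y = "\<lambda>h. (1 / h) *\<^sub>R (S h d - d)"
  have "((\<lambda>u. ?y \<bar>u - t\<bar>) \<longlongrightarrow> A d) ?F"
    by (rule filterlim_compose[OF generator_limit[OF G d] filterlim_abs_diff_at_right])
  then have "((\<lambda>u. C * norm (?y \<bar>u - t\<bar> - A d)) \<longlongrightarrow> C * norm (A d - A d)) ?F"
    by (intro tendsto_intros)
  then have bound: "((\<lambda>u. C * norm (?y \<bar>u - t\<bar> - A d)) \<longlongrightarrow> 0) ?F" by simp
  have "norm (S (min u t) z) \<le> C * norm z" if "u \<in> {0..T}" for u z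
    using C[of "min u t"] t that
    by (intro order_trans[OF norm_blinfun] mult_right_mono) auto
  then have "\<forall>\<^sub>F u in ?F. norm (S (min u t) (?y \<bar>u - t\<bar> - A d)) \<le> C * norm (?y \<bar>u - t\<bar> - A d)"
    by (simp add: eventually_at_filter)
  then have 1: "((\<lambda>u. S (min u t) (?y \<bar>u - t\<bar> - A d)) \<longlongrightarrow> 0) ?F"
    by (rule Lim_null_comparison[OF _ bound])
  have 2: "((\<lambda>u. S (min u t) (A d)) \<longlongrightarrow> S t (A d)) ?F"
  proof -
    have "continuous_on {0..T} (\<lambda>u. S (min u t) (A d))"
      using t by (intro continuous_on_compose2[OF continuous_on_orbit[OF S C]] continuous_intros) auto
    from this[unfolded continuous_on, rule_format, OF t] show ?thesis by simp
  qed
  have "\<forall>\<^sub>F u in ?F. S (min u t) (?y \<bar>u - t\<bar> - A d) + S (min u t) (A d)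
      = (1 / (u - t)) *\<^sub>R (S u d - S t d)"
    unfolding eventually_at_filter
  proof (intro always_eventually allI impI)
    fix u assume "u \<noteq> t" "u \<in> {0..T}"
    then consider "u < t" "0 \<le> u" | "t < u" by fastforce
    then show "S (min u t) (?y \<bar>u - t\<bar> - A d) + S (min u t) (A d) = (1 / (u - t)) *\<^sub>R (S u d - S t d)"
    proof cases
      case 1
      have "(1 / (u - t)) *\<^sub>R (S u d - S t d) = (- (1 / (t - u))) *\<^sub>R (- (S t d - S u d))"
        by (simp add: minus_divide_right)
      also have "\<dots> = (1 / (t - u)) *\<^sub>R (S t d - S u d)"
        by (simp only: scaleR_minus_left scaleR_minus_right minus_minus)
      also have "S t d - S u d = S u (S (t - u) d - d)"
        using 1 semigroup_add[OF S, of u "t - u" d] by (simp add: blinfun.diff_right)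
      finally show ?thesis using 1 by (simp add: blinfun.scaleR_right blinfun.diff_right)
    next
      case 2
      then show ?thesis using semigroup_add[OF S, of t "u - t" d] t
        by (simp add: blinfun.scaleR_right blinfun.diff_right)
    qed
  qed
  then have "((\<lambda>u. (1 / (u - t)) *\<^sub>R (S u d - S t d)) \<longlongrightarrow> 0 + S t (A d)) ?F"
    by (rule Lim_transform_eventually[OF tendsto_add[OF 1 2]])
  then show ?thesis by (simp add: has_vector_derivative_iff_slope)
qed

text \<open>
  The averages \<open>(1 / h) *\<^sub>R integral {0..h} (\<lambda>s. S s x)\<close> belong to the domain, because \<open>S t\<close> merely
  shifts the interval of integration and the integral is differentiable in its end points; they
  converge to \<open>x\<close> as \<open>h\<close> tends to \<open>0\<close>.
\<close>

lemma generator_domain_dense: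
  assumes G: "generator A D S" and C: "\<And>t. t \<in> {0..T} \<Longrightarrow> norm (S t) \<le> C" and T: "0 < T"
  shows "closure D = UNIV"
proof -
  have S: "C0_semigroup S" using G by (simp add: generator_def)
  have "x \<in> closure D" for x
  proof -
    define f where "f s = S s x" for s
    define I where "I u = integral {0..u} f" for u
    have f: "continuous_on {0..T} f"
      unfolding f_def using S C by (rule continuous_on_orbit)
    have int: "f integrable_on {a..b}" if "0 \<le> a" "b \<le> T" for a b
      using that by (intro integrable_continuous_real continuous_on_subset[OF f]) auto
    have I0: "I 0 = 0" by (simp add: I_def)
    have slope: "((\<lambda>u. (1 / (u - h)) *\<^sub>R (I u - I h)) \<longlongrightarrow> f h) (at h within {0..T})"
      if "h \<in> {0..T}" for h
      using integral_has_vector_derivative[OF f that]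
      unfolding I_def by (simp add: has_vector_derivative_iff_slope)
    have slope0: "((\<lambda>u. (1 / u) *\<^sub>R I u) \<longlongrightarrow> x) (at_right 0)"
      using slope[of 0] T S by (simp add: at_within_Icc_at_right I0 f_def C0_semigroup_def)
    have shift: "S t (I h) = I (h + t) - I t" if "0 < t" "0 \<le> h" "h + t \<le> T" for t h
    proof -
      have "S t (I h) = integral {0..h} (\<lambda>s. S t (f s))"
        unfolding I_def using that
        by (subst integral_linear[symmetric, OF int blinfun.bounded_linear_right]) (auto simp: o_def)
      also have "\<dots> = integral {0..h} (\<lambda>s. f (s + t))"
        using that semigroup_add[OF S, of t _ x]
        by (intro integral_cong) (auto simp: f_def add.commute)
      also have "\<dots> = integral {t..h + t} f"
        using integral_shift_Icc_real[of 0 h f t] by (simp add: o_def add.commute)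
      also have "\<dots> = I (h + t) - I t"
        unfolding I_def using that int[of 0 "h + t"] Henstock_Kurzweil_Integration.integral_combine[of 0 t "h + t" f]
        by (simp add: algebra_simps)
      finally show ?thesis .
    qed
    have I_in: "(1 / h) *\<^sub>R I h \<in> D" if h: "0 < h" "h < T" for h
    proof -
      have at: "filterlim (\<lambda>t. h + t) (at h within {0..T}) (at_right 0)"
      proof -
        have "((\<lambda>t. h + t) \<longlongrightarrow> h + 0) (at_right 0)" by (intro tendsto_intros)
        moreover have "\<forall>\<^sub>F t in at_right 0. h + t \<in> {0..T} \<and> h + t \<noteq> h"
          unfolding eventually_at_right_field using h by (intro exI[of _ "T - h"]) auto
        ultimately show ?thesis by (simp add: filterlim_at)
      qed
      have "((\<lambda>t. (1 / (h + t - h)) *\<^sub>R (I (h + t) - I h) - (1 / t) *\<^sub>R I t) \<longlongrightarrow> f h - x) (at_right 0)"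
        by (intro tendsto_diff filterlim_compose[OF slope at] slope0) (use h in auto)
      then have "((\<lambda>t. (1 / h) *\<^sub>R ((1 / (h + t - h)) *\<^sub>R (I (h + t) - I h) - (1 / t) *\<^sub>R I t))
            \<longlongrightarrow> (1 / h) *\<^sub>R (f h - x)) (at_right 0)"
        by (rule tendsto_scaleR[OF tendsto_const])
      moreover have "\<forall>\<^sub>F t in at_right 0.
          (1 / h) *\<^sub>R ((1 / (h + t - h)) *\<^sub>R (I (h + t) - I h) - (1 / t) *\<^sub>R I t) =
          (1 / t) *\<^sub>R (S t ((1 / h) *\<^sub>R I h) - (1 / h) *\<^sub>R I h)"
        unfolding eventually_at_right_field
      proof (intro exI[of _ "T - h"] conjI allI impI)
        fix t assume t: "0 < t" "t < T - h"
        then have "S t (I h) = I (h + t) - I t" using h by (intro shift) auto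
        then show "(1 / h) *\<^sub>R ((1 / (h + t - h)) *\<^sub>R (I (h + t) - I h) - (1 / t) *\<^sub>R I t) =
          (1 / t) *\<^sub>R (S t ((1 / h) *\<^sub>R I h) - (1 / h) *\<^sub>R I h)"
          by (simp add: blinfun.scaleR_right scaleR_diff_right mult.commute)
      qed (use h in auto)
      ultimately have "((\<lambda>t. (1 / t) *\<^sub>R (S t ((1 / h) *\<^sub>R I h) - (1 / h) *\<^sub>R I h))
            \<longlongrightarrow> (1 / h) *\<^sub>R (f h - x)) (at_right 0)"
        by (rule Lim_transform_eventually)
      then show ?thesis by (rule generator_domainI[OF G])
    qed
    show "x \<in> closure D"
    proof (rule Lim_in_closed_set[OF closed_closure _ _ slope0])
      have "\<forall>\<^sub>F h in at_right 0. (1 / h) *\<^sub>R I h \<in> D"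
        unfolding eventually_at_right_field using T I_in by (intro exI[of _ T]) auto
      then show "\<forall>\<^sub>F h in at_right 0. (1 / h) *\<^sub>R I h \<in> closure D"
        by (rule eventually_mono) (use closure_subset in blast)
    qed simp
  qed
  then show ?thesis by blast
qed

section \<open>Monotonicity of the quadratic form along the flow\<close>

lemma self_adjointD:
  assumes "self_adjoint T"
  shows "inner (T x) y = inner x (T y)"
  using inner_adj[of T x y] assms by (simp add: self_adjoint_def)

text \<open>
  Write \<open>x u = x t + w\<close>.  Then \<open>inner (x u) (P u (x u))\<close> is the sum of the form at the fixed
  vector \<open>x t\<close>, of twice the cross term \<open>inner w (P u (x t))\<close>, and of the form at \<open>w\<close>.  The first
  two only involve \<open>P\<close> at the fixed vector \<open>x t\<close>, where strong differentiability applies; the last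
  is of second order in \<open>u - t\<close>, because the form is bounded uniformly in \<open>u\<close>.  So the product rule
  holds without differentiability of \<open>P\<close> in operator norm.
\<close>

lemma quadratic_form_has_derivative:
  assumes sa: "\<And>u. u \<in> X \<Longrightarrow> self_adjoint (P u)"
    and bd: "\<And>u z. u \<in> X \<Longrightarrow> \<bar>inner z (P u z)\<bar> \<le> c * (norm z)\<^sup>2"
    and P: "((\<lambda>u. P u (x t)) has_vector_derivative p) (at t within X)"
    and x: "(x has_vector_derivative v) (at t within X)"
  shows "((\<lambda>u. inner (x u) (P u (x u))) has_real_derivative
           inner (x t) p + 2 * inner v (P t (x t))) (at t within X)"
proof -
  let ?F = "at t within X"
  let ?q = "\<lambda>u. (1 / (u - t)) *\<^sub>R (x u - x t)"
  let ?p = "\<lambda>u. (1 / (u - t)) *\<^sub>R (P u (x t) - P t (x t))"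
  have q: "(?q \<longlongrightarrow> v) ?F" and p: "(?p \<longlongrightarrow> p) ?F"
    using P x by (simp_all add: has_vector_derivative_iff_slope)
  have Pt: "((\<lambda>u. P u (x t)) \<longlongrightarrow> P t (x t)) ?F"
    using has_vector_derivative_continuous[OF P] by (simp add: continuous_within)
  \<comment> \<open>The form at the increment, divided by \<open>u - t\<close>, is \<open>(u - t) * inner (?q u) (P u (?q u))\<close>.\<close>
  have "((\<lambda>u. \<bar>u - t\<bar> * (c * (norm (?q u))\<^sup>2)) \<longlongrightarrow> \<bar>t - t\<bar> * (c * (norm v)\<^sup>2)) ?F"
    by (intro tendsto_intros q)
  then have bound: "((\<lambda>u. \<bar>u - t\<bar> * (c * (norm (?q u))\<^sup>2)) \<longlongrightarrow> 0) ?F" by simp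
  have "\<forall>\<^sub>F u in ?F. norm ((u - t) * inner (?q u) (P u (?q u))) \<le> \<bar>u - t\<bar> * (c * (norm (?q u))\<^sup>2)"
    unfolding eventually_at_filter
  proof (intro always_eventually allI impI)
    fix u assume "u \<in> X"
    show "norm ((u - t) * inner (?q u) (P u (?q u))) \<le> \<bar>u - t\<bar> * (c * (norm (?q u))\<^sup>2)"
      unfolding real_norm_def abs_mult by (intro mult_left_mono bd \<open>u \<in> X\<close>) simp
  qed
  then have rem: "((\<lambda>u. (u - t) * inner (?q u) (P u (?q u))) \<longlongrightarrow> 0) ?F"
    by (rule Lim_null_comparison[OF _ bound])
  have "((\<lambda>u. inner (x t) (?p u) + 2 * inner (?q u) (P u (x t)) + (u - t) * inner (?q u) (P u (?q u)))
      \<longlongrightarrow> inner (x t) p + 2 * inner v (P t (x t)) + 0) ?F"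
    by (intro tendsto_add tendsto_mult tendsto_inner tendsto_const p q Pt rem)
  moreover have "\<forall>\<^sub>F u in ?F.
      inner (x t) (?p u) + 2 * inner (?q u) (P u (x t)) + (u - t) * inner (?q u) (P u (?q u))
      = (inner (x u) (P u (x u)) - inner (x t) (P t (x t))) / (u - t)"
    unfolding eventually_at_filter
  proof (intro always_eventually allI impI)
    fix u assume u: "u \<noteq> t" "u \<in> X"
    define w where "w = x u - x t"
    define r where "r = 1 / (u - t)"
    have r: "(u - t) * (r * (r * z)) = r * z" for z using u by (simp add: r_def)
    have quot: "z / (u - t) = r * z" for z by (simp add: r_def)
    have xu: "x u = x t + w" by (simp add: w_def)
    have sym: "inner (x t) (P u w) = inner w (P u (x t))"
      using self_adjointD[OF sa[OF u(2)], of "x t" w] by (simp add: inner_commute)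
    show "inner (x t) (?p u) + 2 * inner (?q u) (P u (x t)) + (u - t) * inner (?q u) (P u (?q u))
      = (inner (x u) (P u (x u)) - inner (x t) (P t (x t))) / (u - t)"
      unfolding quot w_def[symmetric] r_def[symmetric]
      unfolding xu blinfun.add_right blinfun.scaleR_right inner_add_left inner_add_right
        inner_scaleR_left inner_scaleR_right inner_diff_right sym
      using r[of "inner w (P u w)"] by (simp add: algebra_simps)
  qed
  ultimately show ?thesis
    unfolding has_field_derivative_iff by (simp add: Lim_transform_eventually)
qed

text \<open>
  On the domain the derivative of the form along the orbit is the left-hand side of \<open>diss\<close> at
  \<open>S t d\<close>, which again lies in the domain.  Both sides of the resulting inequality are continuous
  in the initial vector, so it extends from the dense domain to the whole space.
\<close>

lemma quadratic_form_nonincreasing: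
  assumes G: "generator A D S" and C: "\<And>t. t \<in> {0..T} \<Longrightarrow> norm (S t) \<le> C"
    and sa: "\<And>\<tau>. \<tau> \<in> {0..T} \<Longrightarrow> self_adjoint (P \<tau>)"
    and bd: "\<And>\<tau> z. \<tau> \<in> {0..T} \<Longrightarrow> \<bar>inner z (P \<tau> z)\<bar> \<le> c * (norm z)\<^sup>2"
    and diff: "strongly_differentiable_on P {0..T}"
    and diss: "\<And>d \<tau>. d \<in> D \<Longrightarrow> \<tau> \<in> {0<..<T} \<Longrightarrow>
      inner d (strong_derivative P {0..T} \<tau> d) + 2 * inner (A d) (P \<tau> d) \<le> 0"
    and \<theta>: "0 < \<theta>" "\<theta> \<le> T"
  shows "inner (S \<theta> x) (P \<theta> (S \<theta> x)) \<le> inner x (P 0 x)"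
proof -
  have S0: "S 0 z = z" for z using G by (simp add: generator_def C0_semigroup_def)
  have *: "inner (S \<theta> d) (P \<theta> (S \<theta> d)) \<le> inner d (P 0 d)" if d: "d \<in> D" for d
  proof -
    let ?V = "\<lambda>u. inner (S u d) (P u (S u d))"
    have V: "(?V has_real_derivative
        inner (S t d) (strong_derivative P {0..T} t (S t d)) + 2 * inner (A (S t d)) (P t (S t d)))
        (at t within {0..T})" if t: "t \<in> {0..T}" for t
    proof (rule quadratic_form_has_derivative[OF sa bd])
      show "((\<lambda>u. P u (S t d)) has_vector_derivative strong_derivative P {0..T} t (S t d)) (at t within {0..T})"
        using diff t unfolding strongly_differentiable_on_def strong_derivative_def
        by (simp add: vector_derivative_works[symmetric])
      show "((\<lambda>u. S u d) has_vector_derivative A (S t d)) (at t within {0..T})"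
        using orbit_has_vector_derivative[OF G C d t] generator_commutes_semigroup(2)[OF G d, of t] t
        by simp
    qed auto
    have "?V 0 \<ge> ?V \<theta>"
    proof (rule DERIV_nonpos_imp_decreasing_open[where f = ?V])
      show "\<exists>y. (?V has_real_derivative y) (at t) \<and> y \<le> 0" if t: "0 < t" "t < \<theta>" for t
      proof (intro exI conjI)
        show "(?V has_real_derivative
          inner (S t d) (strong_derivative P {0..T} t (S t d)) + 2 * inner (A (S t d)) (P t (S t d))) (at t)"
          using V[of t] t \<theta> by (simp add: at_within_Icc_at)
        show "inner (S t d) (strong_derivative P {0..T} t (S t d)) + 2 * inner (A (S t d)) (P t (S t d)) \<le> 0"
          using t \<theta> by (intro diss generator_commutes_semigroup(1)[OF G d]) auto
      qed
      have "continuous_on {0..T} ?V" using V by (rule DERIV_continuous_on)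
      then show "continuous_on {0..\<theta>} ?V" by (rule continuous_on_subset) (use \<theta> in auto)
    qed (use \<theta> in auto)
    then show ?thesis by (simp add: S0)
  qed
  have "closed {x. inner (S \<theta> x) (P \<theta> (S \<theta> x)) \<le> inner x (P 0 x)}"
    by (intro closed_Collect_le continuous_intros)
  then have "closure D \<subseteq> {x. inner (S \<theta> x) (P \<theta> (S \<theta> x)) \<le> inner x (P 0 x)}"
    by (intro closure_minimal) (use * in auto)
  moreover have "closure D = UNIV" using \<theta> by (intro generator_domain_dense[OF G C]) auto
  ultimately show ?thesis by auto
qed

section \<open>Impulse times in an interval\<close>

lemma impulse_seqs_bracket:
  assumes \<sigma>: "\<sigma> \<in> impulse_seqs" and s: "0 \<le> s"
  obtains k where "\<sigma> k \<le> s" "s < \<sigma> (Suc k)"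
proof -
  have "eventually (\<lambda>k. s < \<sigma> k) sequentially"
    using \<sigma> by (simp add: impulse_seqs_def filterlim_at_top_dense)
  then obtain N where "s < \<sigma> N" by (auto simp: eventually_sequentially)
  moreover have "\<not> s < \<sigma> 0" using \<sigma> s by (simp add: impulse_seqs_def)
  ultimately have "\<exists>k<N. (\<forall>i\<le>k. \<not> s < \<sigma> i) \<and> s < \<sigma> (Suc k)"
    by (intro ex_least_nat_less) auto
  then show ?thesis using that by (auto simp: not_less)
qed

lemma impulse_times_in_interval:
  assumes \<sigma>: "\<sigma> \<in> impulse_seqs"
    and k: "\<sigma> k \<le> s" "s < \<sigma> (Suc k)" and m: "\<sigma> m \<le> t" "t < \<sigma> (Suc m)"
  shows "sorted_list_of_set (impulse_times \<sigma> \<inter> {s<..t}) = map \<sigma> [Suc k..<Suc m]"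
    and "impulse_count \<sigma> t s = m - k"
proof -
  have mono: "strict_mono \<sigma>" using \<sigma> by (simp add: impulse_seqs_def strict_mono_Suc_iff)
  have le: "i \<le> j \<Longrightarrow> \<sigma> i \<le> \<sigma> j" for i j
    using strict_mono_less_eq[OF mono] by blast
  have "s < \<sigma> i \<longleftrightarrow> Suc k \<le> i" for i
    using k le[of i k] le[of "Suc k" i] by (cases "Suc k \<le> i") auto
  moreover have "\<sigma> i \<le> t \<longleftrightarrow> i < Suc m" for i
    using m le[of i m] le[of "Suc m" i] by (cases "i < Suc m") auto
  ultimately have eq: "impulse_times \<sigma> \<inter> {s<..t} = set (map \<sigma> [Suc k..<Suc m])"
    by (auto simp: impulse_times_def)
  have "sorted (map \<sigma> [Suc k..<Suc m])"
    using le by (intro sorted_map_mono) (auto simp: mono_on_def simp del: upt_Suc)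
  moreover have dist: "distinct (map \<sigma> [Suc k..<Suc m])"
    using strict_mono_imp_inj_on[OF mono] by (simp add: distinct_map del: upt_Suc)
  ultimately show "sorted_list_of_set (impulse_times \<sigma> \<inter> {s<..t}) = map \<sigma> [Suc k..<Suc m]"
    unfolding eq by (simp only: sorted_list_of_set_sort_remdups sorted_sort_id distinct_remdups_id)
  show "impulse_count \<sigma> t s = m - k"
    unfolding impulse_count_def eq using distinct_card[OF dist] by (simp del: upt_Suc)
qed

section \<open>From decay at the impulses to exponential stability\<close>

text \<open>
  \<open>W \<theta> z\<close> is the value of the Lyapunov function when the state is \<open>z\<close> and the time \<open>\<theta>\<close> has passed
  since the last impulse.  Just before each impulse it is at most \<open>q\<close> times its value just before
  the preceding one.  It is bounded below by the squared norm only for \<open>\<theta>\<close> in \<open>{Tmin..Tmax}\<close>, so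
  the norm is estimated just before the last impulse \<open>\<sigma> m\<close>, and the remaining factor
  \<open>S (t - \<sigma> m)\<close> \<open>J\<close> is estimated in operator norm.  The induction runs over the starting impulse, from
  the last one backwards, with \<open>z\<close> the state just before it.
\<close>

lemma impulse_prod_decay:
  fixes S :: "real \<Rightarrow> ('a::{real_inner,banach} \<Rightarrow>\<^sub>L 'a)" and J :: "'a \<Rightarrow>\<^sub>L 'a"
    and W :: "real \<Rightarrow> 'a \<Rightarrow> real"
  assumes flow: "\<And>\<theta> z. \<theta> \<in> {Tmin..Tmax} \<Longrightarrow> W \<theta> (S \<theta> z) \<le> W 0 z"
    and jump: "\<And>\<theta> z. \<theta> \<in> {Tmin..Tmax} \<Longrightarrow> W 0 (J z) \<le> q * W \<theta> z"
    and coercive: "\<And>\<theta> z. \<theta> \<in> {Tmin..Tmax} \<Longrightarrow> a * (norm z)\<^sup>2 \<le> W \<theta> z"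
    and a: "0 \<le> a" and q: "0 \<le> q"
    and C: "\<And>\<tau>. \<tau> \<in> {0..Tmax} \<Longrightarrow> norm (S \<tau>) \<le> C"
    and gaps: "\<And>i. \<sigma> (Suc i) - \<sigma> i \<in> {Tmin..Tmax}"
    and t: "\<sigma> m \<le> t" "t \<le> \<sigma> (Suc m)"
    and k: "k \<le> m" and \<theta>: "\<theta> \<in> {Tmin..Tmax}"
  shows "a * (norm (impulse_prod S J t (\<sigma> k) (map \<sigma> [Suc k..<Suc m]) (J z)))\<^sup>2
           \<le> (C * norm J)\<^sup>2 * q ^ (m - k) * W \<theta> z"
  using k \<theta>
proof (induction k arbitrary: z \<theta> rule: inc_induct)
  case base
  have \<tau>: "t - \<sigma> m \<in> {0..Tmax}" using t gaps[of m] by auto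
  have "norm (S (t - \<sigma> m) (J z)) \<le> norm (S (t - \<sigma> m)) * norm (J z)" by (rule norm_blinfun)
  also have "\<dots> \<le> C * (norm J * norm z)"
    using order_trans[OF norm_ge_zero C[OF \<tau>]] by (intro mult_mono norm_blinfun C[OF \<tau>]) auto
  finally have "a * (norm (S (t - \<sigma> m) (J z)))\<^sup>2 \<le> a * (C * (norm J * norm z))\<^sup>2"
    using a by (intro mult_left_mono power_mono) auto
  also have "\<dots> = (C * norm J)\<^sup>2 * (a * (norm z)\<^sup>2)" by (simp add: power_mult_distrib mult_ac)
  also have "\<dots> \<le> (C * norm J)\<^sup>2 * W \<theta> z"
    using coercive[OF base] by (intro mult_left_mono) auto
  finally show ?case by simp
next
  case (step n)
  let ?\<theta> = "\<sigma> (Suc n) - \<sigma> n"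
  let ?z = "S ?\<theta> (J z)"
  have list: "map \<sigma> [Suc n..<Suc m] = \<sigma> (Suc n) # map \<sigma> [Suc (Suc n)..<Suc m]"
    using step.hyps by (simp add: upt_conv_Cons del: upt_Suc)
  have "a * (norm (impulse_prod S J t (\<sigma> n) (map \<sigma> [Suc n..<Suc m]) (J z)))\<^sup>2
      \<le> (C * norm J)\<^sup>2 * q ^ (m - Suc n) * W ?\<theta> ?z"
    unfolding list using step.IH[OF gaps, of ?z n] by (simp del: upt_Suc)
  also have "\<dots> \<le> (C * norm J)\<^sup>2 * q ^ (m - Suc n) * (q * W \<theta> z)"
    using flow[OF gaps, of n "J z"] jump[OF step.prems, of z] q by (intro mult_left_mono) auto
  also have "\<dots> = (C * norm J)\<^sup>2 * q ^ (m - n) * W \<theta> z"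
    using step.hyps by (simp add: Suc_diff_Suc[symmetric])
  finally show ?case .
qed

text \<open>
  Up to the first impulse after \<open>s\<close> the bound on \<open>S\<close> suffices, so \<open>impulse_prod_decay\<close> makes the
  squared norm of the propagator decay like \<open>q ^ \<kappa>\<close> in the number \<open>\<kappa>\<close> of impulses.  As
  impulses are at most \<open>Tmax\<close> apart, \<open>t - s \<le> (\<kappa> + 1) * Tmax\<close>, and part of the decay in \<open>\<kappa>\<close> can be
  traded for decay in time.
\<close>

lemma strongly_UGES_of_sampled_decay:
  fixes S :: "real \<Rightarrow> ('a::{real_inner,banach} \<Rightarrow>\<^sub>L 'a)" and J :: "'a \<Rightarrow>\<^sub>L 'a"
    and W :: "real \<Rightarrow> 'a \<Rightarrow> real"
  assumes T: "0 < Tmin" "Tmin \<le> Tmax"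
    and flow: "\<And>\<theta> z. \<theta> \<in> {Tmin..Tmax} \<Longrightarrow> W \<theta> (S \<theta> z) \<le> W 0 z"
    and jump: "\<And>\<theta> z. \<theta> \<in> {Tmin..Tmax} \<Longrightarrow> W 0 (J z) \<le> q * W \<theta> z"
    and coercive: "\<And>\<theta> z. \<theta> \<in> {Tmin..Tmax} \<Longrightarrow> a * (norm z)\<^sup>2 \<le> W \<theta> z"
    and upper: "\<And>\<theta> z. \<theta> \<in> {Tmin..Tmax} \<Longrightarrow> W \<theta> z \<le> b * (norm z)\<^sup>2"
    and a: "0 < a" and b: "0 \<le> b" and q: "0 < q" "q < 1"
    and C: "\<And>\<tau>. \<tau> \<in> {0..Tmax} \<Longrightarrow> norm (S \<tau>) \<le> C" "1 \<le> C"
  shows "strongly_UGES S J (impulse_seqs_rng Tmin Tmax)"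
proof -
  \<comment> \<open>The norm decays like \<open>sqrt q ^ \<kappa> = \<rho> ^ (2 * \<kappa>)\<close>: one factor \<open>\<rho> ^ \<kappa>\<close> is kept, and the other one,
      times \<open>\<rho>\<close>, is at most \<open>exp (- \<alpha> * (t - s))\<close>.  That extra \<open>\<rho>\<close> is the denominator of \<open>M\<close>.\<close>
  define \<rho> where "\<rho> = root 4 q"
  have \<rho>: "0 < \<rho>" "\<rho> < 1" using q by (simp_all add: \<rho>_def)
  have q_eq: "q = \<rho> ^ 4" using q by (simp add: \<rho>_def)
  define \<alpha> where "\<alpha> = - ln \<rho> / Tmax"
  have \<alpha>: "0 < \<alpha>" using \<rho> T by (simp add: \<alpha>_def divide_neg_pos)
  \<comment> \<open>The factor \<open>1 / q\<close> occurs because the first of the \<open>\<kappa>\<close> impulses does not contribute a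
      contraction: its preceding state is only estimated by the norm of \<open>x\<close>.\<close>
  define L where "L = sqrt ((C * norm J)\<^sup>2 * b * C\<^sup>2 / (a * q))"
  have L2: "L\<^sup>2 = (C * norm J)\<^sup>2 * b * C\<^sup>2 / (a * q)"
    unfolding L_def using a b q by (intro real_sqrt_pow2) auto
  have L: "0 \<le> L" unfolding L_def using a b q by simp
  define M where "M = max C L / \<rho>"
  have M: "1 \<le> M" using C(2) \<rho> by (simp add: M_def field_simps)
  have "norm (propagator S J \<sigma> t s) \<le> M * \<rho> ^ impulse_count \<sigma> t s * exp (- \<alpha> * (t - s))"
    if \<sigma>r: "\<sigma> \<in> impulse_seqs_rng Tmin Tmax" and st: "0 \<le> s" "s \<le> t" for \<sigma> s t
  proof -
    have \<sigma>: "\<sigma> \<in> impulse_seqs" and gaps: "\<And>i. \<sigma> (Suc i) - \<sigma> i \<in> {Tmin..Tmax}"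
      using \<sigma>r by (auto simp: impulse_seqs_rng_def)
    have mono: "strict_mono \<sigma>" using \<sigma> by (simp add: impulse_seqs_def strict_mono_Suc_iff)
    obtain k where k: "\<sigma> k \<le> s" "s < \<sigma> (Suc k)" using impulse_seqs_bracket[OF \<sigma> st(1)] .
    obtain m where m: "\<sigma> m \<le> t" "t < \<sigma> (Suc m)"
      using impulse_seqs_bracket[OF \<sigma>, of t] st by auto
    have "\<sigma> k < \<sigma> (Suc m)" using k m st by linarith
    then have km: "k \<le> m" using strict_mono_less[OF mono] by simp
    define \<kappa> where "\<kappa> = impulse_count \<sigma> t s"
    have \<kappa>: "\<kappa> = m - k"
      and prod_eq: "propagator S J \<sigma> t s = impulse_prod S J t s (map \<sigma> [Suc k..<Suc m])"
      using impulse_times_in_interval[OF \<sigma> k m] by (simp_all only: \<kappa>_def propagator_def)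
    have decay: "norm (propagator S J \<sigma> t s) \<le> max C L * \<rho> ^ (2 * \<kappa>)"
    proof (cases "k = m")
      case True
      have "t - s \<in> {0..Tmax}" using k m st gaps[of k] True by auto
      then show ?thesis using C(1)[of "t - s"] True by (simp add: prod_eq \<kappa>)
    next
      case False
      with km have km': "Suc k \<le> m" by simp
      have \<tau>: "\<sigma> (Suc k) - s \<in> {0..Tmax}" using k gaps[of k] by auto
      have Tm: "Tmin \<in> {Tmin..Tmax}" using T by simp
      show ?thesis
      proof (rule norm_blinfun_bound)
        fix x
        let ?z = "S (\<sigma> (Suc k) - s) x"
        have list: "map \<sigma> [Suc k..<Suc m] = \<sigma> (Suc k) # map \<sigma> [Suc (Suc k)..<Suc m]"
          using km' by (simp add: upt_conv_Cons del: upt_Suc)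
        have "norm ?z \<le> C * norm x"
          using C(1)[OF \<tau>] by (intro order_trans[OF norm_blinfun] mult_right_mono) auto
        then have z: "(norm ?z)\<^sup>2 \<le> C\<^sup>2 * (norm x)\<^sup>2"
          unfolding power_mult_distrib[symmetric] by (intro power_mono) auto
        have "a * (norm (propagator S J \<sigma> t s x))\<^sup>2
            = a * (norm (impulse_prod S J t (\<sigma> (Suc k)) (map \<sigma> [Suc (Suc k)..<Suc m]) (J ?z)))\<^sup>2"
          unfolding prod_eq list by (simp del: upt_Suc)
        also have "\<dots> \<le> (C * norm J)\<^sup>2 * q ^ (m - Suc k) * W Tmin ?z"
          using flow jump coercive less_imp_le[OF a] less_imp_le[OF q(1)] C(1) gaps m(1)
            less_imp_le[OF m(2)] km' Tm
          by (rule impulse_prod_decay)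
        also have "\<dots> \<le> (C * norm J)\<^sup>2 * q ^ (m - Suc k) * (b * (C\<^sup>2 * (norm x)\<^sup>2))"
          using q b z by (intro mult_left_mono order_trans[OF upper[OF Tm]]) auto
        also have "\<dots> = a * (L\<^sup>2 * q ^ \<kappa> * (norm x)\<^sup>2)"
          using a q km' by (simp add: L2 \<kappa> Suc_diff_Suc[symmetric] field_simps)
        also have "\<dots> = a * (L * \<rho> ^ (2 * \<kappa>) * norm x)\<^sup>2"
          by (simp add: q_eq power_mult_distrib power_mult[symmetric] mult.commute)
        finally have "(norm (propagator S J \<sigma> t s x))\<^sup>2 \<le> (L * \<rho> ^ (2 * \<kappa>) * norm x)\<^sup>2"
          using a by simp
        then have "norm (propagator S J \<sigma> t s x) \<le> L * \<rho> ^ (2 * \<kappa>) * norm x"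
          by (rule power2_le_imp_le) (use L \<rho> in simp)
        also have "\<dots> \<le> max C L * \<rho> ^ (2 * \<kappa>) * norm x"
          using \<rho> by (intro mult_right_mono) auto
        finally show "norm (propagator S J \<sigma> t s x) \<le> max C L * \<rho> ^ (2 * \<kappa>) * norm x" .
      qed (use C(2) \<rho> in auto)
    qed
    have "\<sigma> (k + j) \<le> \<sigma> k + j * Tmax" for j
    proof (induction j)
      case (Suc j)
      then show ?case using gaps[of "k + j"] by (simp add: algebra_simps)
    qed simp
    from this[of "Suc m - k"] have "t - s \<le> real (Suc \<kappa>) * Tmax"
      using k m km by (simp add: \<kappa> Suc_diff_le)
    then have "\<alpha> * (t - s) \<le> \<alpha> * (real (Suc \<kappa>) * Tmax)" using \<alpha> by (intro mult_left_mono) auto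
    also have "\<dots> = - (real (Suc \<kappa>) * ln \<rho>)" using T by (simp add: \<alpha>_def)
    finally have "exp (real (Suc \<kappa>) * ln \<rho>) \<le> exp (- \<alpha> * (t - s))" by simp
    then have time: "\<rho> ^ Suc \<kappa> \<le> exp (- \<alpha> * (t - s))" using \<rho> by (simp add: exp_of_nat_mult del: of_nat_Suc power_Suc)
    have "max C L * \<rho> ^ (2 * \<kappa>) = M * \<rho> ^ \<kappa> * \<rho> ^ Suc \<kappa>"
      using \<rho> by (simp add: M_def mult_2 power_add)
    also have "\<dots> \<le> M * \<rho> ^ \<kappa> * exp (- \<alpha> * (t - s))"
      using M \<rho> by (intro mult_left_mono time) auto
    finally show ?thesis using decay by (simp add: \<kappa>_def)
  qed
  then show ?thesis unfolding strongly_UGES_def using M \<alpha> \<rho> by blast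
qed

text \<open>
  The sequence of the multiples of \<open>Tmax\<close> belongs to the family and has no impulse before \<open>Tmax\<close>, so
  the growth condition bounds the semigroup itself on \<open>{0..<Tmax}\<close>.  The semigroup law
  \<open>S \<tau> = S (\<tau> / 2) o\<^sub>L S (\<tau> / 2)\<close> adds the end point.
\<close>

lemma growth_condition_semigroup_bounded:
  assumes S: "C0_semigroup S" and T: "0 < Tmin" "Tmin \<le> Tmax"
    and growth: "growth_condition S J Tmin Tmax"
  obtains C where "1 \<le> C" "\<And>\<tau>. \<tau> \<in> {0..Tmax} \<Longrightarrow> norm (S \<tau>) \<le> C"
proof -
  define \<sigma> :: "nat \<Rightarrow> real" where "\<sigma> k = real k * Tmax" for k
  have lim: "filterlim \<sigma> at_top sequentially"
    unfolding \<sigma>_def using T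
    by (intro filterlim_at_top_mult_tendsto_pos[OF tendsto_const] filterlim_real_sequentially) auto
  have \<sigma>: "\<sigma> \<in> impulse_seqs_rng Tmin Tmax"
    using T lim by (auto simp: impulse_seqs_rng_def impulse_seqs_def \<sigma>_def algebra_simps)
  obtain g \<mu> where g: "\<And>s t x. 0 \<le> s \<Longrightarrow> s \<le> t \<Longrightarrow>
        norm (propagator S J \<sigma> t s x) \<le> g (t - s) * \<mu> ^ impulse_count \<sigma> t s * norm x"
      "bdd_above (g ` {0..<Tmax})"
    using growth \<sigma> unfolding growth_condition_def by blast
  then obtain G where G: "\<And>\<tau>. \<tau> \<in> {0..<Tmax} \<Longrightarrow> g \<tau> \<le> G" unfolding bdd_above_def by blast
  define K where "K = max 1 G"
  have K: "norm (S \<tau>) \<le> K" if \<tau>: "\<tau> \<in> {0..<Tmax}" for \<tau>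
  proof (rule norm_blinfun_bound)
    fix x
    have "\<sigma> 0 \<le> 0" "0 < \<sigma> (Suc 0)" "\<sigma> 0 \<le> \<tau>" "\<tau> < \<sigma> (Suc 0)" using \<tau> T by (auto simp: \<sigma>_def)
    moreover have "\<sigma> \<in> impulse_seqs" using \<sigma> by (simp add: impulse_seqs_rng_def)
    ultimately have "propagator S J \<sigma> \<tau> 0 = S \<tau>" "impulse_count \<sigma> \<tau> 0 = 0"
      using impulse_times_in_interval[of \<sigma> 0 0 0 \<tau>] by (simp_all add: propagator_def)
    then have "norm (S \<tau> x) \<le> g \<tau> * norm x" using g(1)[of 0 \<tau> x] \<tau> by simp
    also have "\<dots> \<le> K * norm x" using G[OF \<tau>] by (intro mult_right_mono) (auto simp: K_def)
    finally show "norm (S \<tau> x) \<le> K * norm x" .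
  qed (simp add: K_def)
  have "norm (S \<tau>) \<le> K * K" if \<tau>: "\<tau> \<in> {0..Tmax}" for \<tau>
  proof -
    have "S \<tau> = S (\<tau> / 2) o\<^sub>L S (\<tau> / 2)"
      using S \<tau> unfolding C0_semigroup_def by (metis atLeastAtMost_iff field_sum_of_halves half_bounded_equal divide_nonneg_nonneg zero_le_numeral)
    then have "norm (S \<tau>) \<le> norm (S (\<tau> / 2)) * norm (S (\<tau> / 2))"
      by (simp add: norm_blinfun_compose)
    also have "\<dots> \<le> K * K" using \<tau> T by (intro mult_mono K) (auto simp: K_def)
    finally show ?thesis .
  qed
  moreover have "1 \<le> K * K" by (simp add: K_def mult_ge1_I)
  ultimately show ?thesis using that by blast
qed

section \<open>Stability from the Lyapunov equations\<close>

theorem theorem6p13: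
  fixes A :: "'a::{real_inner,banach} \<Rightarrow> 'a" and D :: "'a set"
    and S :: "real \<Rightarrow> ('a \<Rightarrow>\<^sub>L 'a)" and J :: "'a \<Rightarrow>\<^sub>L 'a"
    and P Q R :: "real \<Rightarrow> ('a \<Rightarrow>\<^sub>L 'a)"
    and Tmin Tmax c\<^sub>P \<alpha>\<^sub>q \<alpha>\<^sub>r :: real
  assumes "0 < Tmin" and "Tmin \<le> Tmax"
    and "generator A D S"
    and "J \<noteq> 0" and "blinfun_apply J ` D \<subseteq> D"
    and "growth_condition S J Tmin Tmax"
    and "\<And>\<tau>. \<tau> \<in> {0..Tmax} \<Longrightarrow> self_adjoint (P \<tau>)"
    and "strongly_differentiable_on P {0..Tmax}"
    and "c\<^sub>P > 0"
    and "\<And>\<tau>. \<tau> \<in> {0..Tmax} \<Longrightarrow> 0 \<prec> P \<tau> \<and> P \<tau> \<preceq> c\<^sub>P *\<^sub>R id_blinfun"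
    and "\<And>\<tau>. \<tau> \<in> {0..Tmax} \<Longrightarrow> self_adjoint (Q \<tau>)"
    and "\<And>\<theta>. \<theta> \<in> {Tmin..Tmax} \<Longrightarrow> self_adjoint (R \<theta>)"
    and "\<alpha>\<^sub>q > 0" and "\<alpha>\<^sub>r > 0"
    and "\<And>\<tau>. \<tau> \<in> {0..Tmax} \<Longrightarrow> \<alpha>\<^sub>q *\<^sub>R id_blinfun \<preceq> Q \<tau>"
    and "\<And>\<theta>. \<theta> \<in> {Tmin..Tmax} \<Longrightarrow> \<alpha>\<^sub>r *\<^sub>R id_blinfun \<preceq> R \<theta>"
    and "\<And>d \<tau>. d \<in> D \<Longrightarrow> \<tau> \<in> {0<..<Tmax} \<Longrightarrow>
           inner d (strong_derivative P {0..Tmax} \<tau> d)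
           + (inner (A d) (P \<tau> d) + inner (P \<tau> d) (A d))
           + inner d (Q \<tau> d) = 0"
    and "\<And>\<theta>. \<theta> \<in> {Tmin..Tmax} \<Longrightarrow> (adj J o\<^sub>L P 0 o\<^sub>L J) - P \<theta> + R \<theta> = 0"
  shows "strongly_UGES S J (impulse_seqs_rng Tmin Tmax)"
proof -
  note T = assms(1,2) and G = assms(3) and growth = assms(6) and sa = assms(7)
    and diff = assms(8) and c\<^sub>P = assms(9) and \<alpha>\<^sub>q = assms(13) and \<alpha>\<^sub>r = assms(14)
    and Q = assms(15) and R = assms(16) and flow_eq = assms(17) and jump_eq = assms(18)
  define W where "W \<tau> z = inner z (P \<tau> z)" for \<tau> z
  have W_pos: "0 \<le> W \<tau> z" and W_le: "W \<tau> z \<le> c\<^sub>P * (norm z)\<^sup>2" if "\<tau> \<in> {0..Tmax}" for \<tau> z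
  proof -
    show "0 \<le> W \<tau> z"
      using assms(10)[OF that] unfolding op_less_def W_def by (cases "z = 0") (auto intro: less_imp_le)
    show "W \<tau> z \<le> c\<^sub>P * (norm z)\<^sup>2"
      using assms(10)[OF that]
      by (simp add: op_le_def W_def blinfun.diff_left blinfun.scaleR_left inner_diff_right power2_norm_eq_inner)
  qed
  have R_ge: "\<alpha>\<^sub>r * (norm z)\<^sup>2 \<le> inner z (R \<theta> z)" if "\<theta> \<in> {Tmin..Tmax}" for \<theta> z
    using R[OF that]
    by (simp add: op_le_def blinfun.diff_left blinfun.scaleR_left inner_diff_right power2_norm_eq_inner)
  \<comment> \<open>The jump equation does two things: it contracts the form at an impulse, and, as \<open>P 0\<close> is
      nonnegative, it makes the form coercive just before an impulse.\<close>
  have W_jump: "W 0 (J z) = W \<theta> z - inner z (R \<theta> z)" if "\<theta> \<in> {Tmin..Tmax}" for \<theta> z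
  proof -
    have "((adj J o\<^sub>L P 0 o\<^sub>L J) - P \<theta> + R \<theta>) z = 0" using jump_eq[OF that] by simp
    then have "inner z (adj J (P 0 (J z))) - W \<theta> z + inner z (R \<theta> z) = inner z 0"
      unfolding W_def inner_diff_right[symmetric] inner_add_right[symmetric]
      by (simp add: blinfun.diff_left blinfun.add_left)
    then show ?thesis using inner_adj[of J "P 0 (J z)" z] by (simp add: W_def inner_commute)
  qed
  \<comment> \<open>The maximum with \<open>1 / 2\<close> makes the contraction factor positive at once.\<close>
  define q where "q = max (1 / 2) (1 - \<alpha>\<^sub>r / c\<^sub>P)"
  have q: "0 < q" "q < 1" using \<alpha>\<^sub>r c\<^sub>P by (simp_all add: q_def)
  have S: "C0_semigroup S" using G by (simp add: generator_def)
  obtain C where C: "1 \<le> C" "\<And>\<tau>. \<tau> \<in> {0..Tmax} \<Longrightarrow> norm (S \<tau>) \<le> C"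
    using growth_condition_semigroup_bounded[OF S T growth] by blast
  show ?thesis
  proof (rule strongly_UGES_of_sampled_decay[where W = W and q = q and a = \<alpha>\<^sub>r and b = c\<^sub>P and C = C])
    fix \<theta> z assume \<theta>: "\<theta> \<in> {Tmin..Tmax}"
    then have \<theta>0: "\<theta> \<in> {0..Tmax}" using T by auto
    show "W \<theta> (S \<theta> z) \<le> W 0 z"
      unfolding W_def
    proof (rule quadratic_form_nonincreasing[OF G C(2) sa _ diff])
      show "\<bar>inner y (P \<tau> y)\<bar> \<le> c\<^sub>P * (norm y)\<^sup>2" if "\<tau> \<in> {0..Tmax}" for \<tau> y
        using W_pos[OF that, of y] W_le[OF that, of y] by (simp add: W_def)
      show "inner d (strong_derivative P {0..Tmax} \<tau> d) + 2 * inner (A d) (P \<tau> d) \<le> 0"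
        if "d \<in> D" "\<tau> \<in> {0<..<Tmax}" for d \<tau>
      proof -
        have "\<alpha>\<^sub>q * (norm d)\<^sup>2 \<le> inner d (Q \<tau> d)"
          using Q[of \<tau>] that(2)
          by (simp add: op_le_def blinfun.diff_left blinfun.scaleR_left inner_diff_right power2_norm_eq_inner)
        moreover have "0 \<le> \<alpha>\<^sub>q * (norm d)\<^sup>2" using \<alpha>\<^sub>q by simp
        ultimately show ?thesis using flow_eq[OF that] by (simp add: inner_commute)
      qed
    qed (use \<theta> T in auto)
    show "\<alpha>\<^sub>r * (norm z)\<^sup>2 \<le> W \<theta> z"
      using W_jump[OF \<theta>, of z] R_ge[OF \<theta>, of z] W_pos[of 0 "J z"] T by simp
    show "W \<theta> z \<le> c\<^sub>P * (norm z)\<^sup>2" by (rule W_le[OF \<theta>0])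
    show "W 0 (J z) \<le> q * W \<theta> z"
    proof -
      have "\<alpha>\<^sub>r / c\<^sub>P * W \<theta> z \<le> \<alpha>\<^sub>r / c\<^sub>P * (c\<^sub>P * (norm z)\<^sup>2)"
        using \<alpha>\<^sub>r c\<^sub>P by (intro mult_left_mono W_le \<theta>0) auto
      also have "\<dots> = \<alpha>\<^sub>r * (norm z)\<^sup>2" using c\<^sub>P by simp
      finally have "W 0 (J z) \<le> (1 - \<alpha>\<^sub>r / c\<^sub>P) * W \<theta> z"
        using W_jump[OF \<theta>, of z] R_ge[OF \<theta>, of z] by (simp add: left_diff_distrib)
      also have "\<dots> \<le> q * W \<theta> z"
        using W_pos[OF \<theta>0] by (intro mult_right_mono) (simp_all add: q_def)
      finally show ?thesis .
    qed
  qed (use T q \<alpha>\<^sub>r c\<^sub>P C in auto)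
qed

end
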